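(* Let $K$ be a finite graph and $L$ an induced subgraph. Let $S$ be a compact surface (possibly with boundary) and let $\Psi$ be a van Kampen diagram over $X_K$ on $S$ which is essential and such that every boundary edge of $S$ is labeled by a vertex of $L$. Let $D(S)$ be the surface obtained from $S$ and a copy $S'$ of $S$ by identifying each boundary component of $S$ with the corresponding boundary component of $S'$, and let $D(\Psi)$ be the map $D(S)\to X_K\cup_{X_L}X_K=X_{K*_LK}$ which is $\Psi$ on $S$ (into the first copy of $X_K$) and the copy of $\Psi$ on $S'$ (into the second copy). Then $D(\Psi)$ is faithful, i.e. the induced homomorphism $\pi_1(D(S),x)\to A(K*_LK)\cong A(K)*_{A(L)}A(K)$ (for a basepoint $x$ in $S$) is injective.
   Context: $A(K)$ is the right-angled Artin group of $K$. $X_K$ is its standard square complex (one vertex, one oriented edge labeled $a$ for each vertex $a$ of $K$, one square with boundary $aba^{-1}b^{-1}$ for each edge $\{a,b\}$ of $K$); $X_L\subseteq X_K$ is the subcomplex for $L$. The double $K*_LK$ is the graph obtained from two copies of $K$ by identifying them along $L$; $A(K*_LK)=A(K)*_{A(L)}A(K)$. A van Kampen diagram over $X_K$ on $S$ is a polygonal decomposition of $S$ together with a cellular map to $X_K$ (so edges carry labels in $K^0$ and each 2-cell is a square); it induces a homomorphism $\pi_1(S,x)\to A(K)$ ($x$ a vertex) by reading labels along edge loops, and it is faithful if this homomorphism is injective. For an edge path $\alpha$ with endpoints on $\partial S$, the word read along $\alpha$ represents an element $g$ of $A(K)$; its reduced content $\mathrm{rcont}(\alpha)$ is the smallest set $V$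 of vertices with $g\in A(V)=\langle V\rangle$. An essential arc is an arc with endpoints on $\partial S$ not homotopic relative to its endpoints into $\partial S$. $\Psi$ is essential if it is faithful and for every essential arc $\alpha$ with endpoints on $\partial S$, $\mathrm{rcont}(\alpha)\not\subseteq L^0$. *)

theory Defs
  imports Main
begin

text \<open>Combinatorial model. A polygonal (square) decomposition of a compact surface is
a finite 2-complex: vertices, oriented edges, and square 2-cells whose boundary is a
closed edge path of length 4 (a list of darts; (e,True) traverses e from src to tgt).\<close>

record ('v,'e,'f) cplx =
  verts :: "'v set"
  edges :: "'e set"
  faces :: "'f set"
  src :: "'e \<Rightarrow> 'v"
  tgt :: "'e \<Rightarrow> 'v"
  bnd :: "'f \<Rightarrow> ('e \<times> bool) list"

definition dstart :: "('v,'e,'f,'z) cplx_scheme \<Rightarrow> 'e \<times> bool \<Rightarrow> 'v" where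
  "dstart C d = (if snd d then src C (fst d) else tgt C (fst d))"

definition dend :: "('v,'e,'f,'z) cplx_scheme \<Rightarrow> 'e \<times> bool \<Rightarrow> 'v" where
  "dend C d = (if snd d then tgt C (fst d) else src C (fst d))"

definition dinv :: "'e \<times> bool \<Rightarrow> 'e \<times> bool" where
  "dinv d = (fst d, \<not> snd d)"

definition rev_path :: "('e \<times> bool) list \<Rightarrow> ('e \<times> bool) list" where
  "rev_path p = rev (map dinv p)"

text \<open>Edge paths from u to w.\<close>
fun is_path :: "('v,'e,'f,'z) cplx_scheme \<Rightarrow> 'v \<Rightarrow> ('e \<times> bool) list \<Rightarrow> 'v \<Rightarrow> bool" where
  "is_path C u [] w = (u \<in> verts C \<and> u = w)"
| "is_path C u (d # p) w = (fst d \<in> edges C \<and> dstart C d = u \<and> is_path C (dend C d) p w)"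

text \<open>Combinatorial homotopy of edge paths rel endpoints (edge-path groupoid):
generated by inserting/deleting backtracks and boundary loops of 2-cells.\<close>
definition face_loops :: "('v,'e,'f,'z) cplx_scheme \<Rightarrow> 'f \<Rightarrow> ('e \<times> bool) list set" where
  "face_loops C f = {rotate k (bnd C f) | k. True} \<union> {rotate k (rev_path (bnd C f)) | k. True}"

definition hstep :: "('v,'e,'f,'z) cplx_scheme \<Rightarrow> ('e \<times> bool) list \<Rightarrow> ('e \<times> bool) list \<Rightarrow> bool" where
  "hstep C p q \<longleftrightarrow>
     (\<exists>a b d. p = a @ d # dinv d # b \<and> q = a @ b) \<or>
     (\<exists>a b f r. f \<in> faces C \<and> r \<in> face_loops C f \<and> p = a @ b \<and> q = a @ r @ b)"

definition homotopic :: "('v,'e,'f,'z) cplx_scheme \<Rightarrow> 'v \<Rightarrow> ('e \<times> bool) list \<Rightarrow> ('e \<times> bool) list \<Rightarrow> 'v \<Rightarrow> bool" where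
  "homotopic C u p q w \<longleftrightarrow> is_path C u p w \<and>
     (p, q) \<in> {(p', q'). is_path C u p' w \<and> is_path C u q' w \<and> (hstep C p' q' \<or> hstep C q' p')}\<^sup>*"

definition cplx_wf :: "('v,'e,'f,'z) cplx_scheme \<Rightarrow> bool" where
  "cplx_wf C \<longleftrightarrow> finite (verts C) \<and> finite (edges C) \<and> finite (faces C) \<and>
     (\<forall>e\<in>edges C. src C e \<in> verts C \<and> tgt C e \<in> verts C) \<and>
     (\<forall>f\<in>faces C. length (bnd C f) = 4 \<and>
        is_path C (dstart C (hd (bnd C f))) (bnd C f) (dstart C (hd (bnd C f))))"

text \<open>Number of sides of 2-cells along which the edge e runs.\<close>
definition occ :: "('v,'e,'f,'z) cplx_scheme \<Rightarrow> 'e \<Rightarrow> nat" where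
  "occ C e = (\<Sum>f\<in>faces C. count_list (map fst (bnd C f)) e)"

text \<open>Link of a vertex: nodes are half-edges at v ((e,True) = the src-end of e),
link edges are corners of 2-cells.\<close>
definition halves :: "('v,'e,'f,'z) cplx_scheme \<Rightarrow> 'v \<Rightarrow> ('e \<times> bool) set" where
  "halves C v = {h. fst h \<in> edges C \<and> dstart C h = v}"

definition linkrel :: "('v,'e,'f,'z) cplx_scheme \<Rightarrow> (('e \<times> bool) \<times> ('e \<times> bool)) set" where
  "linkrel C = {(dinv (bnd C f ! i), bnd C f ! ((i + 1) mod 4)) | f i. f \<in> faces C \<and> i < 4}"

text \<open>Compact surface: every edge lies on one or two sides of 2-cells and every
vertex link is nonempty and connected (hence an arc or a circle).\<close>
definition surface :: "('v,'e,'f,'z) cplx_scheme \<Rightarrow> bool" where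
  "surface C \<longleftrightarrow> cplx_wf C \<and> (\<forall>e\<in>edges C. occ C e \<in> {1, 2}) \<and>
     (\<forall>v\<in>verts C. halves C v \<noteq> {} \<and>
        (\<forall>h1\<in>halves C v. \<forall>h2\<in>halves C v. (h1, h2) \<in> (linkrel C \<union> (linkrel C)\<inverse>)\<^sup>*))"

definition bd_edges :: "('v,'e,'f,'z) cplx_scheme \<Rightarrow> 'e set" where
  "bd_edges C = {e \<in> edges C. occ C e = 1}"

definition bd_verts :: "('v,'e,'f,'z) cplx_scheme \<Rightarrow> 'v set" where
  "bd_verts C = {v. \<exists>e\<in>bd_edges C. v = src C e \<or> v = tgt C e}"

text \<open>Finite simple graph (K0, EK); L is the induced subgraph on L0 \<subseteq> K0.\<close>
definition finite_graph :: "'k set \<Rightarrow> ('k \<Rightarrow> 'k \<Rightarrow> bool) \<Rightarrow> bool" where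
  "finite_graph K0 EK \<longleftrightarrow> finite K0 \<and>
     (\<forall>a b. EK a b \<longrightarrow> a \<in> K0 \<and> b \<in> K0 \<and> a \<noteq> b \<and> EK b a)"

text \<open>Right-angled Artin group A(K): words over generators and inverses
((a,True) = a, (a,False) = a^-1), modulo free cancellation and commutation of
adjacent letters a, b with {a,b} an edge of K.\<close>
definition rstep :: "('k \<Rightarrow> 'k \<Rightarrow> bool) \<Rightarrow> (('k \<times> bool) list \<times> ('k \<times> bool) list) set" where
  "rstep EK = {(a @ [(x, s), (x, \<not> s)] @ b, a @ b) | a b x s. True} \<union>
              {(a @ [(x, s), (y, t)] @ b, a @ [(y, t), (x, s)] @ b) | a b x y s t. EK x y}"

definition raag_eq :: "('k \<Rightarrow> 'k \<Rightarrow> bool) \<Rightarrow> ('k \<times> bool) list \<Rightarrow> ('k \<times> bool) list \<Rightarrow> bool" where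
  "raag_eq EK w w' \<longleftrightarrow> (w, w') \<in> (rstep EK \<union> (rstep EK)\<inverse>)\<^sup>*"

text \<open>w represents an element of A(V) = <V>.\<close>
definition in_parabolic :: "('k \<Rightarrow> 'k \<Rightarrow> bool) \<Rightarrow> 'k set \<Rightarrow> ('k \<times> bool) list \<Rightarrow> bool" where
  "in_parabolic EK V w \<longleftrightarrow> (\<exists>w'. fst ` set w' \<subseteq> V \<and> raag_eq EK w w')"

text \<open>Reduced content: the smallest V with g in A(V) (= the intersection of all such V).\<close>
definition rcont :: "'k set \<Rightarrow> ('k \<Rightarrow> 'k \<Rightarrow> bool) \<Rightarrow> ('k \<times> bool) list \<Rightarrow> 'k set" where
  "rcont K0 EK w = \<Inter> {V. V \<subseteq> K0 \<and> in_parabolic EK V w}"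

definition word :: "('e \<Rightarrow> 'k) \<Rightarrow> ('e \<times> bool) list \<Rightarrow> ('k \<times> bool) list" where
  "word lab p = map (\<lambda>(e, b). (lab e, b)) p"

text \<open>Van Kampen diagram over X_K on the surface C: edge labels in K^0 and every
2-cell is a square reading (a cyclic permutation of) a b a^-1 b^-1, {a,b} in K.\<close>
definition vk_diagram :: "'k set \<Rightarrow> ('k \<Rightarrow> 'k \<Rightarrow> bool) \<Rightarrow> ('v,'e,'f,'z) cplx_scheme \<Rightarrow> ('e \<Rightarrow> 'k) \<Rightarrow> bool" where
  "vk_diagram K0 EK C lab \<longleftrightarrow> surface C \<and> (\<forall>e\<in>edges C. lab e \<in> K0) \<and>
     (\<forall>f\<in>faces C. word lab (bnd C f) \<in>
        {rotate k [(a, True), (b, True), (a, False), (b, False)] | k a b. EK a b})"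

text \<open>Faithful: pi_1(S,x) -> A(K) injective for every vertex x.\<close>
definition faithful :: "('k \<Rightarrow> 'k \<Rightarrow> bool) \<Rightarrow> ('v,'e,'f,'z) cplx_scheme \<Rightarrow> ('e \<Rightarrow> 'k) \<Rightarrow> bool" where
  "faithful EK C lab \<longleftrightarrow> (\<forall>x\<in>verts C. \<forall>p q. is_path C x p x \<and> is_path C x q x \<and>
      raag_eq EK (word lab p) (word lab q) \<longrightarrow> homotopic C x p q x)"

text \<open>Essential arc: edge path between boundary vertices not homotopic rel endpoints
into the boundary subcomplex.\<close>
definition essential_arc :: "('v,'e,'f,'z) cplx_scheme \<Rightarrow> ('e \<times> bool) list \<Rightarrow> bool" where
  "essential_arc C p \<longleftrightarrow> (\<exists>u w. u \<in> bd_verts C \<and> w \<in> bd_verts C \<and> is_path C u p w \<and>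
      \<not> (\<exists>q. fst ` set q \<subseteq> bd_edges C \<and> homotopic C u p q w))"

definition essential :: "'k set \<Rightarrow> ('k \<Rightarrow> 'k \<Rightarrow> bool) \<Rightarrow> 'k set \<Rightarrow> ('v,'e,'f,'z) cplx_scheme \<Rightarrow> ('e \<Rightarrow> 'k) \<Rightarrow> bool" where
  "essential K0 EK L0 C lab \<longleftrightarrow> faithful EK C lab \<and>
     (\<forall>p. essential_arc C p \<longrightarrow> \<not> rcont K0 EK (word lab p) \<subseteq> L0)"

text \<open>The double K *_L K: vertices of L are shared, others come in two copies.\<close>
definition dblv :: "'k set \<Rightarrow> bool \<Rightarrow> 'k \<Rightarrow> 'k \<times> bool" where
  "dblv L0 c a = (a, if a \<in> L0 then False else c)"

definition dblE :: "('k \<Rightarrow> 'k \<Rightarrow> bool) \<Rightarrow> 'k set \<Rightarrow> 'k \<times> bool \<Rightarrow> 'k \<times> bool \<Rightarrow> bool" where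
  "dblE EK L0 x y \<longleftrightarrow> (\<exists>c a b. EK a b \<and> x = dblv L0 c a \<and> y = dblv L0 c b)"

text \<open>The double D(S): two copies of S glued by the identity along the boundary.\<close>
definition dsv :: "('v,'e,'f,'z) cplx_scheme \<Rightarrow> bool \<Rightarrow> 'v \<Rightarrow> 'v \<times> bool" where
  "dsv C c v = (v, if v \<in> bd_verts C then False else c)"

definition dse :: "('v,'e,'f,'z) cplx_scheme \<Rightarrow> bool \<Rightarrow> 'e \<Rightarrow> 'e \<times> bool" where
  "dse C c e = (e, if e \<in> bd_edges C then False else c)"

definition double :: "('v,'e,'f) cplx \<Rightarrow> ('v \<times> bool, 'e \<times> bool, 'f \<times> bool) cplx" where
  "double C = \<lparr> verts = {dsv C c v | c v. v \<in> verts C},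
                edges = {dse C c e | c e. e \<in> edges C},
                faces = {(f, c) | f c. f \<in> faces C},
                src = (\<lambda>(e, c). dsv C c (src C e)),
                tgt = (\<lambda>(e, c). dsv C c (tgt C e)),
                bnd = (\<lambda>(f, c). map (\<lambda>(e, b). (dse C c e, b)) (bnd C f)) \<rparr>"

text \<open>D(Psi): Psi on the copy c into the c-th copy of X_K.\<close>
definition dlab :: "'k set \<Rightarrow> ('e \<Rightarrow> 'k) \<Rightarrow> 'e \<times> bool \<Rightarrow> 'k \<times> bool" where
  "dlab L0 lab = (\<lambda>(e, c). dblv L0 c (lab e))"

end

theory Submission
  imports Defs
begin

text \<open>A loop in the double is cut into edge paths of \<open>C\<close>, each in one of the two copies. If its
  word is trivial in \<open>A(K) *\<^bsub>A(L)\<^esub> A(K)\<close>, then by the normal form theorem one of these paths reads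
  an element of \<open>A(L)\<close>. Essentiality makes this path homotopic into the boundary, so that it can be
  moved to the other copy and merged with its neighbours. This ends with a loop in a single copy, where
  faithfulness applies.

  For the normal form theorem, a word of the double is folded to a word of \<open>A(K)\<close>, and one lists the
  cosets of \<open>A(L)\<close> at which it passes from one copy to the other, where equal neighbours cancel. This
  list depends only on the element of the group, and nothing cancels if the factors alternate and lie
  outside \<open>A(L)\<close>.\<close>

section \<open>Words and relabelling\<close>

text \<open>Words and edge paths are lists of the same kind: \<open>rev_path\<close> also inverts words, and
  \<open>word f\<close> also carries a path along a cellular map with edge map \<open>f\<close>.\<close>

lemma fst_dinv [simp]: "fst (dinv d) = fst d"
  and dinv_dinv [simp]: "dinv (dinv d) = d"
  by (simp_all add: dinv_def)

lemma rev_path_simps [simp]: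
  "rev_path [] = []"
  "rev_path (d # p) = rev_path p @ [dinv d]"
  "rev_path (p @ q) = rev_path q @ rev_path p"
  by (simp_all add: rev_path_def)

lemma rev_path_rev_path [simp]: "rev_path (rev_path p) = p"
  by (induction p) simp_all

lemma fst_set_rev_path [simp]: "fst ` set (rev_path p) = fst ` set p"
  by (induction p) simp_all

lemma word_simps [simp]:
  "word f [] = []"
  "word f (d # p) = (f (fst d), snd d) # word f p"
  "word f (p @ q) = word f p @ word f q"
  by (simp_all add: word_def case_prod_unfold)

lemma word_word: "word f (word g p) = word (f \<circ> g) p"
  by (induction p) simp_all

lemma word_cong: "(\<And>x. x \<in> fst ` set p \<Longrightarrow> f x = g x) \<Longrightarrow> word f p = word g p"
  by (induction p) simp_all

lemma word_id [simp]: "word (\<lambda>x. x) p = p"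
  by (induction p) simp_all

lemma word_rev_path: "word f (rev_path p) = rev_path (word f p)"
  by (induction p) (simp_all add: dinv_def)

lemma word_rotate: "word f (rotate k p) = rotate k (word f p)"
  by (simp add: word_def rotate_map)

definition segment_word :: "('c \<Rightarrow> 'a \<Rightarrow> 'b) \<Rightarrow> ('c \<times> ('a \<times> bool) list) list \<Rightarrow> ('b \<times> bool) list" where
  "segment_word f S = concat (map (\<lambda>(c, w). word (f c) w) S)"

lemma segment_word_simps [simp]:
  "segment_word f [] = []"
  "segment_word f ((c, w) # S) = word (f c) w @ segment_word f S"
  "segment_word f (S @ T) = segment_word f S @ segment_word f T"
  by (simp_all add: segment_word_def)

section \<open>Right-angled Artin groups\<close>

lemma rstep_cancel: "(a @ d # dinv d # b, a @ b) \<in> rstep E"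
proof -
  have "a @ d # dinv d # b = a @ [(fst d, snd d), (fst d, \<not> snd d)] @ b"
    by (simp add: dinv_def)
  then show ?thesis unfolding rstep_def by blast
qed

lemma rstep_swap:
  assumes "E (fst d) (fst e)"
  shows "(a @ d # e # b, a @ e # d # b) \<in> rstep E"
proof -
  have "a @ d # e # b = a @ [(fst d, snd d), (fst e, snd e)] @ b"
    and "a @ e # d # b = a @ [(fst e, snd e), (fst d, snd d)] @ b" by simp_all
  with assms show ?thesis unfolding rstep_def by blast
qed

lemma rstepE [consumes 1, case_names cancel swap]:
  assumes "(w, w') \<in> rstep E"
  obtains a d b where "w = a @ d # dinv d # b" "w' = a @ b"
    | a d e b where "E (fst d) (fst e)" "w = a @ d # e # b" "w' = a @ e # d # b"
  using assms unfolding rstep_def dinv_def by fastforce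

lemma raag_eq_refl [simp]: "raag_eq E w w"
  by (simp add: raag_eq_def)

lemma raag_eq_sym: "raag_eq E w w' \<Longrightarrow> raag_eq E w' w"
  unfolding raag_eq_def by (metis sym_Un_converse sym_rtrancl symD)

lemma raag_eq_trans [trans]: "raag_eq E u v \<Longrightarrow> raag_eq E v w \<Longrightarrow> raag_eq E u w"
  unfolding raag_eq_def by (rule rtrancl_trans)

lemma rstep_imp_raag_eq: "(w, w') \<in> rstep E \<Longrightarrow> raag_eq E w w'"
  unfolding raag_eq_def by blast

lemma raag_eq_invariant:
  assumes "raag_eq E w w'" and "\<And>v v'. (v, v') \<in> rstep E \<Longrightarrow> f v = f v'"
  shows "f w = f w'"
  using assms(1) unfolding raag_eq_def by induction (auto dest: assms(2))

lemma raag_eq_image: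
  assumes "raag_eq E w w'" and "\<And>v v'. (v, v') \<in> rstep E \<Longrightarrow> raag_eq E' (f v) (f v')"
  shows "raag_eq E' (f w) (f w')"
  using assms(1) unfolding raag_eq_def[of E]
proof induction
  case (step v v')
  then have "raag_eq E' (f v) (f v')" using assms(2) raag_eq_sym by blast
  with step.IH show ?case by (rule raag_eq_trans)
qed simp

lemma raag_eq_context:
  assumes "raag_eq E w w'"
  shows "raag_eq E (u @ w @ v) (u @ w' @ v)"
  using assms
proof (rule raag_eq_image)
  fix w w' assume "(w, w') \<in> rstep E"
  then have "(u @ w @ v, u @ w' @ v) \<in> rstep E"
  proof (cases rule: rstepE)
    case (cancel a d b)
    then show ?thesis using rstep_cancel[of "u @ a" d "b @ v"] by simp
  next
    case (swap a d e b)
    then show ?thesis using rstep_swap[of E d e "u @ a" "b @ v"] by simp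
  qed
  then show "raag_eq E (u @ w @ v) (u @ w' @ v)" by (rule rstep_imp_raag_eq)
qed

lemma raag_eq_append:
  assumes "raag_eq E u u'" "raag_eq E v v'"
  shows "raag_eq E (u @ v) (u' @ v')"
proof -
  have "raag_eq E (u @ v) (u' @ v)" using raag_eq_context[OF assms(1), of "[]" v] by simp
  also have "raag_eq E (u' @ v) (u' @ v')" using raag_eq_context[OF assms(2), of u' "[]"] by simp
  finally show ?thesis .
qed

lemma raag_eq_word:
  assumes "raag_eq E w w'" and hom: "\<And>x y. E x y \<Longrightarrow> E' (f x) (f y)"
  shows "raag_eq E' (word f w) (word f w')"
  using assms(1)
proof (rule raag_eq_image)
  fix w w' assume "(w, w') \<in> rstep E"
  then have "(word f w, word f w') \<in> rstep E'"
  proof (cases rule: rstepE)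
    case (cancel a d b)
    then show ?thesis
      using rstep_cancel[of "word f a" "(f (fst d), snd d)" "word f b"] by (simp add: dinv_def)
  next
    case (swap a d e b)
    then show ?thesis
      using rstep_swap[of E' "(f (fst d), snd d)" "(f (fst e), snd e)"] hom by simp
  qed
  then show "raag_eq E' (word f w) (word f w')" by (rule rstep_imp_raag_eq)
qed

lemma raag_eq_rev_path_right: "raag_eq E (w @ rev_path w) []"
proof (induction w)
  case (Cons d w)
  have "raag_eq E ([d] @ (w @ rev_path w) @ [dinv d]) ([d] @ [] @ [dinv d])"
    by (rule raag_eq_context) (rule Cons.IH)
  also have "raag_eq E \<dots> []"
    using rstep_cancel[of "[]" d "[]"] by (simp add: rstep_imp_raag_eq)
  finally show ?case by simp
qed simp

lemma raag_eq_rev_path_left: "raag_eq E (rev_path w @ w) []"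
  using raag_eq_rev_path_right[of E "rev_path w"] by simp

lemma raag_eq_rev_path:
  assumes "raag_eq E w w'"
  shows "raag_eq E (rev_path w) (rev_path w')"
proof -
  have "raag_eq E (rev_path w) (rev_path w @ w' @ rev_path w')"
    using raag_eq_append[OF raag_eq_refl raag_eq_sym[OF raag_eq_rev_path_right]] by fastforce
  also have "raag_eq E \<dots> (rev_path w @ w @ rev_path w')"
    by (rule raag_eq_context) (rule raag_eq_sym[OF assms])
  also have "raag_eq E \<dots> (rev_path w')"
    using raag_eq_append[OF raag_eq_rev_path_left raag_eq_refl] by fastforce
  finally show ?thesis .
qed

lemma raag_eq_Nil_append_commute:
  assumes "raag_eq E (u @ v) []"
  shows "raag_eq E (v @ u) []"
proof -
  have "raag_eq E (v @ u) ((rev_path u @ u) @ v @ u)"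
    using raag_eq_append[OF raag_eq_sym[OF raag_eq_rev_path_left] raag_eq_refl] by fastforce
  also have "raag_eq E \<dots> (rev_path u @ u)"
    using raag_eq_context[OF assms, of "rev_path u" u] by simp
  also have "raag_eq E \<dots> []" by (rule raag_eq_rev_path_left)
  finally show ?thesis .
qed

lemma raag_eq_Nil_rotate: "raag_eq E w [] \<Longrightarrow> raag_eq E (rotate k w) []"
  unfolding rotate_drop_take by (rule raag_eq_Nil_append_commute) simp

lemma raag_eq_commutator:
  assumes "E a b"
  shows "raag_eq E [(a, s), (b, t), (a, \<not> s), (b, \<not> t)] []"
proof -
  have "raag_eq E [(a, s), (b, t), (a, \<not> s), (b, \<not> t)] [(b, t), (a, s), (a, \<not> s), (b, \<not> t)]"
    using rstep_swap[of E "(a, s)" "(b, t)" "[]"] assms by (simp add: rstep_imp_raag_eq)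
  also have "raag_eq E \<dots> []"
    using raag_eq_rev_path_right[of E "[(b, t), (a, s)]"] by (simp add: dinv_def)
  finally show ?thesis .
qed

subsection \<open>Parabolic subgroups and their cosets\<close>

lemma in_parabolic_cong: "raag_eq E w w' \<Longrightarrow> in_parabolic E V w \<longleftrightarrow> in_parabolic E V w'"
  using raag_eq_trans raag_eq_sym unfolding in_parabolic_def by meson

lemma in_parabolic_letters: "fst ` set w \<subseteq> V \<Longrightarrow> in_parabolic E V w"
  unfolding in_parabolic_def using raag_eq_refl by blast

lemma in_parabolic_append:
  assumes "in_parabolic E V u" "in_parabolic E V w"
  shows "in_parabolic E V (u @ w)"
proof -
  obtain u' w' where "fst ` set u' \<subseteq> V" "raag_eq E u u'" "fst ` set w' \<subseteq> V" "raag_eq E w w'"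
    using assms unfolding in_parabolic_def by blast
  then have "fst ` set (u' @ w') \<subseteq> V" "raag_eq E (u @ w) (u' @ w')"
    by (auto intro: raag_eq_append)
  then show ?thesis unfolding in_parabolic_def by blast
qed

lemma in_parabolic_rev_path: "in_parabolic E V w \<Longrightarrow> in_parabolic E V (rev_path w)"
  unfolding in_parabolic_def by (metis raag_eq_rev_path fst_set_rev_path)

definition parabolic_coset :: "('k \<Rightarrow> 'k \<Rightarrow> bool) \<Rightarrow> 'k set \<Rightarrow> ('k \<times> bool) list \<Rightarrow> ('k \<times> bool) list set"
  where "parabolic_coset E V p = {q. in_parabolic E V (rev_path p @ q)}"

lemma in_parabolic_rev_path_trans:
  assumes "in_parabolic E V (rev_path p @ q)" "in_parabolic E V (rev_path q @ r)"
  shows "in_parabolic E V (rev_path p @ r)"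
proof -
  have "raag_eq E (rev_path p @ (q @ rev_path q) @ r) (rev_path p @ [] @ r)"
    by (rule raag_eq_context) (rule raag_eq_rev_path_right)
  with in_parabolic_append[OF assms] show ?thesis by (simp add: in_parabolic_cong)
qed

lemma parabolic_coset_eq_iff:
  "parabolic_coset E V p = parabolic_coset E V q \<longleftrightarrow> in_parabolic E V (rev_path p @ q)"
proof
  have "in_parabolic E V (rev_path q @ q)"
    using in_parabolic_cong[OF raag_eq_rev_path_left] in_parabolic_letters[of "[]"] by fastforce
  then show "parabolic_coset E V p = parabolic_coset E V q \<Longrightarrow> in_parabolic E V (rev_path p @ q)"
    unfolding parabolic_coset_def by blast
next
  assume pq: "in_parabolic E V (rev_path p @ q)"
  then have qp: "in_parabolic E V (rev_path q @ p)"
    using in_parabolic_rev_path by fastforce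
  show "parabolic_coset E V p = parabolic_coset E V q"
    unfolding parabolic_coset_def
    using in_parabolic_rev_path_trans[OF pq] in_parabolic_rev_path_trans[OF qp] by blast
qed

lemma parabolic_coset_append_eq_iff:
  "parabolic_coset E V p = parabolic_coset E V (p @ w) \<longleftrightarrow> in_parabolic E V w"
proof -
  have "raag_eq E ((rev_path p @ p) @ w) ([] @ w)"
    by (rule raag_eq_append) (simp_all add: raag_eq_rev_path_left)
  then show ?thesis by (simp add: parabolic_coset_eq_iff in_parabolic_cong)
qed

lemma parabolic_coset_cong:
  assumes "raag_eq E p p'"
  shows "parabolic_coset E V p = parabolic_coset E V p'"
proof -
  have "raag_eq E (rev_path p @ q) (rev_path p' @ q)" for q
    using assms by (simp add: raag_eq_append raag_eq_rev_path)
  then show ?thesis unfolding parabolic_coset_def using in_parabolic_cong by blast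
qed

section \<open>The normal form theorem for the double\<close>

lemma fst_dblv [simp]: "fst (dblv V c a) = a"
  by (simp add: dblv_def)

lemma word_fst_dblv [simp]: "word fst (word (dblv V c) w) = w"
  by (simp add: word_word comp_def)

lemma raag_eq_word_dblv:
  "raag_eq E w w' \<Longrightarrow> raag_eq (dblE E V) (word (dblv V c) w) (word (dblv V c) w')"
  by (erule raag_eq_word) (auto simp: dblE_def)

lemma raag_eq_word_fst: "raag_eq (dblE E V) w w' \<Longrightarrow> raag_eq E (word fst w) (word fst w')"
  by (erule raag_eq_word) (auto simp: dblE_def)

fun toggle :: "'a \<Rightarrow> 'a list \<Rightarrow> 'a list" where
  "toggle q [] = [q]"
| "toggle q (r # S) = (if q = r then S else q # r # S)"

lemma distinct_adj_toggle: "distinct_adj S \<Longrightarrow> distinct_adj (toggle q S)"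
  by (cases S) (auto dest: distinct_adj_ConsD)

lemma toggle_toggle: "distinct_adj S \<Longrightarrow> toggle q (toggle q S) = S"
  by (induction S rule: induct_list012) simp_all

lemma toggle_Cons: "(S \<noteq> [] \<Longrightarrow> hd S \<noteq> q) \<Longrightarrow> toggle q S = q # S"
  by (cases S) auto

text \<open>The stack lists the cosets of \<open>A(V)\<close> crossed by the geodesic of the Bass-Serre tree that
  belongs to the word. Letters of the second copy make a round trip from the first one, so that those
  of a common segment cancel except for the two ends.\<close>

fun crossings :: "('k \<Rightarrow> 'k \<Rightarrow> bool) \<Rightarrow> 'k set \<Rightarrow> ('k \<times> bool) list \<Rightarrow> (('k \<times> bool) \<times> bool) list \<Rightarrow>
    ('k \<times> bool) list set list \<Rightarrow> ('k \<times> bool) list set list" where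
  "crossings E V p [] S = S"
| "crossings E V p (((x, c), s) # w) S = crossings E V (p @ [(x, s)]) w
     (if c then toggle (parabolic_coset E V (p @ [(x, s)])) (toggle (parabolic_coset E V p) S) else S)"

context
  fixes E :: "'k \<Rightarrow> 'k \<Rightarrow> bool" and V :: "'k set"
begin

abbreviation coset where "coset \<equiv> parabolic_coset E V"

lemma crossings_append:
  "crossings E V p (u @ v) S = crossings E V (p @ word fst u) v (crossings E V p u S)"
  by (induction E V p u S rule: crossings.induct) simp_all

lemma distinct_adj_crossings: "distinct_adj S \<Longrightarrow> distinct_adj (crossings E V p w S)"
  by (induction E V p w S rule: crossings.induct) (simp_all add: distinct_adj_toggle)

lemma crossings_prefix_cong: "raag_eq E p p' \<Longrightarrow> crossings E V p w S = crossings E V p' w S"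
proof (induction w arbitrary: p p' S)
  case (Cons d w)
  obtain x c s where d: "d = ((x, c), s)" by (metis surj_pair)
  have px: "raag_eq E (p @ [(x, s)]) (p' @ [(x, s)])" using Cons.prems by (simp add: raag_eq_append)
  show ?case
    using Cons.IH[OF px] parabolic_coset_cong[OF px] parabolic_coset_cong[OF Cons.prems]
    by (simp add: d)
qed simp

lemma crossings_word_dblv:
  assumes "distinct_adj S"
  shows "crossings E V p (word (dblv V c) w) S =
    (if c then toggle (coset (p @ w)) (toggle (coset p) S) else S)"
  using assms
proof (induction w arbitrary: p S)
  case Nil
  then show ?case by (simp add: toggle_toggle)
next
  case (Cons d w)
  obtain x s where d: "d = (x, s)" by fastforce
  show ?case
  proof (cases "x \<in> V")
    case True
    then have "coset p = coset (p @ [(x, s)])"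
      by (simp add: parabolic_coset_append_eq_iff in_parabolic_letters)
    with True Cons.IH[OF Cons.prems, of "p @ [(x, s)]"] show ?thesis by (simp add: d dblv_def)
  next
    case False
    let ?S = "if c then toggle (coset (p @ [(x, s)])) (toggle (coset p) S) else S"
    have "distinct_adj ?S" using Cons.prems by (simp add: distinct_adj_toggle)
    with False Cons.IH[of ?S "p @ [(x, s)]"] Cons.prems show ?thesis
      by (simp add: d dblv_def toggle_toggle distinct_adj_toggle)
  qed
qed

lemma crossings_cancel:
  assumes "distinct_adj S"
  shows "crossings E V p [d, dinv d] S = S"
proof -
  obtain x c s where d: "d = ((x, c), s)" by (metis surj_pair)
  have "raag_eq E (p @ [(x, s), (x, \<not> s)]) p"
    using rstep_imp_raag_eq[OF rstep_cancel[of p "(x, s)" "[]"]] by (simp add: dinv_def)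
  then show ?thesis
    using assms by (simp add: d dinv_def parabolic_coset_cong toggle_toggle distinct_adj_toggle)
qed

lemma crossings_swap:
  assumes "distinct_adj S" "dblE E V (fst d) (fst e)"
  shows "crossings E V p [d, e] S = crossings E V p [e, d] S"
proof -
  obtain c a b where "E a b" and ab: "fst d = dblv V c a" "fst e = dblv V c b"
    using assms(2) unfolding dblE_def by blast
  from \<open>E a b\<close> have "raag_eq E (p @ [(a, snd d), (b, snd e)]) (p @ [(b, snd e), (a, snd d)])"
    using rstep_imp_raag_eq[OF rstep_swap[of E "(a, snd d)" "(b, snd e)" p "[]"]] by simp
  moreover have "[d, e] = word (dblv V c) [(a, snd d), (b, snd e)]"
    "[e, d] = word (dblv V c) [(b, snd e), (a, snd d)]" using ab by (simp_all add: prod_eq_iff)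
  ultimately show ?thesis
    using assms(1) by (simp only: crossings_word_dblv parabolic_coset_cong)
qed

lemma crossings_cong:
  assumes "raag_eq (dblE E V) w w'" and S: "distinct_adj S"
  shows "crossings E V p w S = crossings E V p w' S"
  using assms(1)
proof (rule raag_eq_invariant)
  fix w w' assume step: "(w, w') \<in> rstep (dblE E V)"
  have local_step: "crossings E V p (a @ m @ b) S = crossings E V p (a @ m' @ b) S"
    if agree: "\<And>p S. distinct_adj S \<Longrightarrow> crossings E V p m S = crossings E V p m' S"
      and equal: "raag_eq (dblE E V) m m'" for a m m' b
  proof -
    have "raag_eq E ((p @ word fst a) @ word fst m) ((p @ word fst a) @ word fst m')"
      using raag_eq_word_fst[OF equal] by (simp only: raag_eq_append raag_eq_refl)
    then show ?thesis
      using agree[OF distinct_adj_crossings[OF S]] by (simp only: crossings_append crossings_prefix_cong)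
  qed
  from step show "crossings E V p w S = crossings E V p w' S"
  proof (cases rule: rstepE)
    case (cancel a d b)
    then show ?thesis
      using local_step[of "[d, dinv d]" "[]" a b] rstep_imp_raag_eq[OF rstep_cancel[of "[]" d "[]"]]
      by (simp add: crossings_cancel del: crossings.simps(2))
  next
    case (swap a d e b)
    then show ?thesis
      using local_step[of "[d, e]" "[e, d]" a b, OF crossings_swap]
        rstep_imp_raag_eq[OF rstep_swap[of "dblE E V" d e "[]" "[]"]] by simp
  qed
qed

lemma length_crossings_alternating:
  assumes "distinct_adj (map fst segs)" "\<forall>(c, w)\<in>set segs. \<not> in_parabolic E V w" "distinct_adj S"
    and "S \<noteq> [] \<Longrightarrow> segs \<noteq> [] \<Longrightarrow> hd S = coset p \<longleftrightarrow> \<not> fst (hd segs)"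
  shows "length (crossings E V p (segment_word (dblv V) segs) S) = length S + 2 * length (filter fst segs)"
  using assms
proof (induction segs arbitrary: p S)
  case (Cons seg segs)
  obtain c w where seg: "seg = (c, w)" by fastforce
  have w: "coset p \<noteq> coset (p @ w)"
    using Cons.prems(2) seg by (simp add: parabolic_coset_append_eq_iff)
  let ?S = "if c then toggle (coset (p @ w)) (toggle (coset p) S) else S"
  have S: "?S = (if c then coset (p @ w) # coset p # S else S)"
    using Cons.prems(4) w by (simp add: seg toggle_Cons)
  have "distinct_adj ?S" using Cons.prems(3) by (simp add: distinct_adj_toggle)
  moreover have "hd ?S = coset (p @ w) \<longleftrightarrow> \<not> fst (hd segs)" if "?S \<noteq> []" "segs \<noteq> []"
    using that Cons.prems(1,4) w unfolding S by (auto simp: seg distinct_adj_Cons hd_map)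
  ultimately have "length (crossings E V (p @ w) (segment_word (dblv V) segs) ?S)
      = length ?S + 2 * length (filter fst segs)"
    using Cons.prems(1,2) by (intro Cons.IH) (auto dest: distinct_adj_ConsD)
  then show ?case
    using Cons.prems(3) by (simp add: seg crossings_append crossings_word_dblv S)
qed simp

theorem alternating_product_nontrivial:
  assumes alternating: "distinct_adj (map fst segs)" and "segs \<noteq> []"
    and outside: "\<forall>(c, w)\<in>set segs. \<not> in_parabolic E V w"
  shows "\<not> raag_eq (dblE E V) (segment_word (dblv V) segs) []"
proof
  assume trivial: "raag_eq (dblE E V) (segment_word (dblv V) segs) []"
  have "length (crossings E V [] (segment_word (dblv V) segs) []) = 2 * length (filter fst segs)"
    using length_crossings_alternating[OF alternating outside, of "[]" "[]"] by simp
  then have "filter fst segs = []" using crossings_cong[OF trivial, of "[]" "[]"] by simp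
  then have "\<forall>seg\<in>set segs. \<not> fst seg" by (simp add: filter_empty_conv)
  then obtain w where segs: "segs = [(False, w)]"
    using alternating \<open>segs \<noteq> []\<close> by (cases segs rule: list.exhaust; cases "tl segs") auto
  have "raag_eq E w []" using raag_eq_word_fst[OF trivial] by (simp add: segs)
  then have "in_parabolic E V w" by (simp add: in_parabolic_cong in_parabolic_letters)
  then show False using outside segs by simp
qed

end

section \<open>Edge paths and homotopy\<close>

lemma dstart_dinv [simp]: "dstart C (dinv d) = dend C d"
  and dend_dinv [simp]: "dend C (dinv d) = dstart C d"
  by (simp_all add: dstart_def dend_def dinv_def)

lemma is_path_end: "is_path C u p w \<Longrightarrow> w \<in> verts C"
  by (induction p arbitrary: u) auto

lemma hstep_backtrack: "hstep C (a @ d # dinv d # b) (a @ b)"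
  unfolding hstep_def by blast

lemma hstep_face: "f \<in> faces C \<Longrightarrow> r \<in> face_loops C f \<Longrightarrow> hstep C (a @ b) (a @ r @ b)"
  unfolding hstep_def by blast

lemma hstepE [consumes 1, case_names backtrack face]:
  assumes "hstep C p q"
  obtains a d b where "p = a @ d # dinv d # b" "q = a @ b"
    | a f r b where "f \<in> faces C" "r \<in> face_loops C f" "p = a @ b" "q = a @ r @ b"
  using assms unfolding hstep_def by blast

lemma hstep_context:
  assumes "hstep C p q"
  shows "hstep C (a @ p @ b) (a @ q @ b)"
  using assms
proof (cases rule: hstepE)
  case (backtrack a' d b')
  then show ?thesis using hstep_backtrack[of C "a @ a'" d "b' @ b"] by simp
next
  case (face a' f r b')
  then show ?thesis using hstep_face[of f C r "a @ a'" "b' @ b"] by simp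
qed

lemma homotopic_refl: "is_path C u p w \<Longrightarrow> homotopic C u p p w"
  by (simp add: homotopic_def)

lemma homotopic_trans [trans]:
  "homotopic C u p q w \<Longrightarrow> homotopic C u q r w \<Longrightarrow> homotopic C u p r w"
  unfolding homotopic_def by (auto intro: rtrancl_trans)

lemma homotopic_hstep:
  "is_path C u p w \<Longrightarrow> is_path C u q w \<Longrightarrow> hstep C p q \<or> hstep C q p \<Longrightarrow> homotopic C u p q w"
  unfolding homotopic_def by blast

lemma homotopic_induct [consumes 1, case_names refl step]:
  assumes "homotopic C u p q w"
    and "is_path C u p w \<Longrightarrow> R p"
    and "\<And>q r. is_path C u q w \<Longrightarrow> is_path C u r w \<Longrightarrow> hstep C q r \<or> hstep C r q \<Longrightarrow> R q \<Longrightarrow> R r"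
  shows "R q"
proof -
  have "(p, q) \<in> {(p', q'). is_path C u p' w \<and> is_path C u q' w \<and> (hstep C p' q' \<or> hstep C q' p')}\<^sup>*"
    and "is_path C u p w" using assms(1) by (simp_all add: homotopic_def)
  then show ?thesis by induction (auto intro: assms(2,3))
qed

lemma homotopic_is_path:
  assumes "homotopic C u p q w"
  shows "is_path C u p w" "is_path C u q w"
proof -
  show "is_path C u p w" using assms by (simp add: homotopic_def)
  show "is_path C u q w" using assms by (induction rule: homotopic_induct)
qed

lemma homotopic_sym:
  assumes "homotopic C u p q w"
  shows "homotopic C u q p w"
  using assms
  by (induction rule: homotopic_induct) (blast intro: homotopic_refl homotopic_hstep homotopic_trans)+

lemma homotopic_image:
  assumes "homotopic C u p q w"
    and "\<And>r. is_path C u r w \<Longrightarrow> is_path D x (g r) y"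
    and "\<And>r r'. hstep C r r' \<Longrightarrow> hstep D (g r) (g r')"
  shows "homotopic D x (g p) (g q) y"
  using assms(1)
proof (induction rule: homotopic_induct)
  case refl
  then show ?case using assms(2) by (simp add: homotopic_refl)
next
  case (step q r)
  then have "homotopic D x (g q) (g r) y" using assms(2,3) by (blast intro: homotopic_hstep)
  with step(4) show ?case by (rule homotopic_trans)
qed

lemma homotopic_raag_eq:
  assumes "homotopic C u p q w"
    and faces: "\<And>f. f \<in> faces C \<Longrightarrow> raag_eq E (word lab (bnd C f)) []"
  shows "raag_eq E (word lab p) (word lab q)"
proof -
  have hstep: "raag_eq E (word lab p) (word lab q)" if "hstep C p q" for p q
    using that
  proof (cases rule: hstepE)
    case (backtrack a d b)
    then show ?thesis
      using rstep_cancel[of "word lab a" "(lab (fst d), snd d)" "word lab b"]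
      by (simp add: dinv_def rstep_imp_raag_eq)
  next
    case (face a f r b)
    have "raag_eq E (word lab (rev_path (bnd C f))) []"
      using raag_eq_rev_path[OF faces[OF face(1)]] by (simp add: word_rev_path)
    then have "raag_eq E (word lab r) []"
      using face(2) faces[OF face(1)] by (auto simp: face_loops_def word_rotate raag_eq_Nil_rotate)
    from raag_eq_context[OF raag_eq_sym[OF this], of "word lab a" "word lab b"] show ?thesis
      by (simp add: face)
  qed
  show ?thesis
    using assms(1)
    by (induction rule: homotopic_induct) (use hstep raag_eq_refl raag_eq_sym raag_eq_trans in blast)+
qed

locale polygonal_complex =
  fixes C :: "('v, 'e, 'f, 'z) cplx_scheme"
  assumes src_in_verts: "e \<in> edges C \<Longrightarrow> src C e \<in> verts C"
    and tgt_in_verts: "e \<in> edges C \<Longrightarrow> tgt C e \<in> verts C"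
begin

lemma is_path_start: "is_path C u p w \<Longrightarrow> u \<in> verts C"
  by (cases p) (auto simp: dstart_def src_in_verts tgt_in_verts)

lemma is_path_append: "is_path C u (p @ q) w \<longleftrightarrow> (\<exists>v. is_path C u p v \<and> is_path C v q w)"
  by (induction p arbitrary: u) (auto dest: is_path_start)

lemma is_path_rev_path: "is_path C u p w \<Longrightarrow> is_path C w (rev_path p) u"
proof (induction p arbitrary: u)
  case (Cons d p)
  then have "is_path C (dend C d) [dinv d] u" using is_path_start[OF Cons.prems] by auto
  with Cons show ?case by (auto simp: is_path_append)
qed simp

lemma homotopic_context:
  assumes "homotopic C v p q v'" "is_path C u a v" "is_path C v' b w"
  shows "homotopic C u (a @ p @ b) (a @ q @ b) w"
  using assms(1)
  by (rule homotopic_image) (use assms(2,3) in \<open>auto simp: is_path_append hstep_context\<close>)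

lemma homotopic_rev_path_right: "is_path C u p w \<Longrightarrow> homotopic C u (p @ rev_path p) [] u"
proof (induction p arbitrary: u)
  case Nil
  then show ?case by (auto intro: homotopic_refl)
next
  case (Cons d p)
  have u: "u \<in> verts C" using is_path_start[OF Cons.prems] .
  have p: "is_path C (dend C d) p w" using Cons.prems by simp
  have d: "is_path C u [d] (dend C d)" using Cons.prems is_path_start[OF p] by simp
  have d': "is_path C (dend C d) [dinv d] u" using is_path_rev_path[OF d] u by simp
  have "homotopic C u ([d] @ (p @ rev_path p) @ [dinv d]) ([d] @ [] @ [dinv d]) u"
    by (rule homotopic_context[OF Cons.IH[OF p] d d'])
  also have "homotopic C u ([d] @ [] @ [dinv d]) [] u"
    using d d' u hstep_backtrack[of C "[]" d "[]"] by (intro homotopic_hstep) auto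
  finally show ?case by simp
qed

lemma homotopic_rev_path_left: "is_path C u p w \<Longrightarrow> homotopic C w (rev_path p @ p) [] w"
  using homotopic_rev_path_right[OF is_path_rev_path] by simp

lemma homotopic_Nil_append_commute:
  assumes p: "is_path C u p v" and q: "is_path C v q u" and null: "homotopic C v (q @ p) [] v"
  shows "homotopic C u (p @ q) [] u"
proof -
  have p': "is_path C v (rev_path p) u" using p by (rule is_path_rev_path)
  have "homotopic C u ((p @ q) @ [] @ []) ((p @ q) @ (p @ rev_path p) @ []) u"
    by (rule homotopic_context[OF homotopic_sym[OF homotopic_rev_path_right[OF p]]])
      (use p q is_path_start[OF p] in \<open>auto simp: is_path_append\<close>)
  also have "homotopic C u ((p @ q) @ (p @ rev_path p) @ []) (p @ [] @ rev_path p) u"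
    using homotopic_context[OF null p p'] by simp
  also have "homotopic C u (p @ [] @ rev_path p) [] u"
    using homotopic_rev_path_right[OF p] by simp
  finally show ?thesis by simp
qed

lemma faithfulI:
  assumes null: "\<And>x p. is_path C x p x \<Longrightarrow> raag_eq E (word lab p) [] \<Longrightarrow> homotopic C x p [] x"
  shows "faithful E C lab"
  unfolding faithful_def
proof (intro ballI allI impI, elim conjE)
  fix x p q
  assume x: "x \<in> verts C" and p: "is_path C x p x" and q: "is_path C x q x"
    and eq: "raag_eq E (word lab p) (word lab q)"
  have "raag_eq E (word lab p @ rev_path (word lab q)) (word lab q @ rev_path (word lab q))"
    using eq by (simp add: raag_eq_append)
  also have "raag_eq E \<dots> []" by (rule raag_eq_rev_path_right)
  finally have pq: "homotopic C x (p @ rev_path q) [] x"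
    using p is_path_rev_path[OF q] by (intro null) (auto simp: is_path_append word_rev_path)
  have "homotopic C x (p @ [] @ []) (p @ (rev_path q @ q) @ []) x"
    by (rule homotopic_context[OF homotopic_sym[OF homotopic_rev_path_left[OF q]]]) (use p x in auto)
  also have "homotopic C x (p @ (rev_path q @ q) @ []) ([] @ [] @ q) x"
    using homotopic_context[OF pq, of x "[]" q x] q x by simp
  finally show "homotopic C x p q x" by simp
qed

end

locale cellular_map =
  fixes C :: "('v, 'e, 'f, 'z) cplx_scheme" and D :: "('v2, 'e2, 'f2, 'z2) cplx_scheme"
    and on_verts :: "'v \<Rightarrow> 'v2" and on_edges :: "'e \<Rightarrow> 'e2" and on_faces :: "'f \<Rightarrow> 'f2"
  assumes verts_image: "v \<in> verts C \<Longrightarrow> on_verts v \<in> verts D"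
    and edges_image: "e \<in> edges C \<Longrightarrow> on_edges e \<in> edges D"
    and src_image: "e \<in> edges C \<Longrightarrow> src D (on_edges e) = on_verts (src C e)"
    and tgt_image: "e \<in> edges C \<Longrightarrow> tgt D (on_edges e) = on_verts (tgt C e)"
    and faces_image: "f \<in> faces C \<Longrightarrow> on_faces f \<in> faces D"
    and bnd_image: "f \<in> faces C \<Longrightarrow> bnd D (on_faces f) = word on_edges (bnd C f)"
begin

lemma is_path_word: "is_path C u p w \<Longrightarrow> is_path D (on_verts u) (word on_edges p) (on_verts w)"
  by (induction p arbitrary: u)
    (auto simp: verts_image edges_image src_image tgt_image dstart_def dend_def)

lemma face_loops_image:
  "f \<in> faces C \<Longrightarrow> r \<in> face_loops C f \<Longrightarrow> word on_edges r \<in> face_loops D (on_faces f)"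
  by (auto simp: face_loops_def bnd_image word_rotate word_rev_path)

lemma hstep_word:
  assumes "hstep C p q"
  shows "hstep D (word on_edges p) (word on_edges q)"
  using assms
proof (cases rule: hstepE)
  case (backtrack a d b)
  then show ?thesis
    using hstep_backtrack[of D "word on_edges a" "(on_edges (fst d), snd d)" "word on_edges b"]
    by (simp add: dinv_def)
next
  case (face a f r b)
  then show ?thesis using hstep_face[OF faces_image face_loops_image] by simp
qed

lemma homotopic_word:
  "homotopic C u p q w \<Longrightarrow> homotopic D (on_verts u) (word on_edges p) (word on_edges q) (on_verts w)"
  by (erule homotopic_image) (auto intro: is_path_word hstep_word)

end

section \<open>Cyclically alternating lists\<close>

lemma not_successively_split:
  "\<not> successively P xs \<Longrightarrow> \<exists>us x y vs. xs = us @ x # y # vs \<and> \<not> P x y"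
  by (induction P xs rule: successively.induct) (auto, metis append_Nil, metis append_Cons)

definition cyclically_alternating :: "('c \<times> 'a) list \<Rightarrow> bool" where
  "cyclically_alternating S \<longleftrightarrow> (\<forall>k. distinct_adj (map fst (rotate k S)))"

lemma cyclically_alternating_rotate: "cyclically_alternating S \<Longrightarrow> cyclically_alternating (rotate k S)"
  by (simp add: cyclically_alternating_def rotate_rotate)

lemma cyclically_alternating_imp_distinct_adj: "cyclically_alternating S \<Longrightarrow> distinct_adj (map fst S)"
  unfolding cyclically_alternating_def by (metis rotate0 id_apply)

lemma cyclically_alternating_ConsD:
  assumes "cyclically_alternating (x # S)" "S \<noteq> []"
  shows "fst (hd S) \<noteq> fst x" "fst (last S) \<noteq> fst x"
proof -
  have "distinct_adj (map fst (x # S))" using assms(1) by (rule cyclically_alternating_imp_distinct_adj)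
  then show "fst (hd S) \<noteq> fst x" using assms(2) by (auto simp: distinct_adj_Cons hd_map)
  have "distinct_adj (map fst (rotate (Suc 0) (x # S)))"
    using assms(1) unfolding cyclically_alternating_def by blast
  then show "fst (last S) \<noteq> fst x" using assms(2) by (simp add: distinct_adj_append_iff last_map)
qed

lemma not_cyclically_alternatingE:
  assumes "\<not> cyclically_alternating S"
  obtains k A c p q B where "rotate k S = A @ (c, p) # (c, q) # B"
proof -
  obtain k where "\<not> successively (\<lambda>x y. fst x \<noteq> fst y) (rotate k S)"
    using assms unfolding cyclically_alternating_def distinct_adj_def successively_map by blast
  from not_successively_split[OF this] show ?thesis using that by fastforce
qed

section \<open>The double of a complex\<close>

lemma dsv_eq_iff: "dsv C c u = dsv C c' u' \<longleftrightarrow> u = u' \<and> (u \<in> bd_verts C \<or> c = c')"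
  by (auto simp: dsv_def)

lemma dsv_in_verts_double: "v \<in> verts C \<Longrightarrow> dsv C c v \<in> verts (double C)"
  by (auto simp: double_def)

lemma ends_of_bd_edge: "e \<in> bd_edges C \<Longrightarrow> src C e \<in> bd_verts C \<and> tgt C e \<in> bd_verts C"
  by (auto simp: bd_verts_def)

lemma cellular_map_double: "cellular_map C (double C) (dsv C c) (dse C c) (\<lambda>f. (f, c))"
  by unfold_locales
    (auto simp: double_def dse_def dsv_def word_def ends_of_bd_edge)

lemma word_dse_boundary: "fst ` set q \<subseteq> bd_edges C \<Longrightarrow> word (dse C c) q = word (dse C c') q"
  by (rule word_cong) (auto simp: dse_def)

fun segment_path :: "('v, 'e, 'f) cplx \<Rightarrow> 'v \<times> bool \<Rightarrow> (bool \<times> ('e \<times> bool) list) list \<Rightarrow> 'v \<times> bool \<Rightarrow> bool"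
  where
  "segment_path C x [] y \<longleftrightarrow> x \<in> verts (double C) \<and> x = y"
| "segment_path C x ((c, p) # S) y \<longleftrightarrow>
     (\<exists>u v. x = dsv C c u \<and> is_path C u p v \<and> segment_path C (dsv C c v) S y)"

locale doubled_complex = polygonal_complex C for C :: "('v, 'e, 'f) cplx"
begin

sublocale double: polygonal_complex "double C"
  by unfold_locales
    (fastforce simp: double_def dse_def dest: src_in_verts tgt_in_verts split: if_splits)+

lemma is_path_word_dse:
  "is_path C u p w \<Longrightarrow> is_path (double C) (dsv C c u) (word (dse C c) p) (dsv C c w)"
  by (rule cellular_map.is_path_word[OF cellular_map_double])

lemma segment_path_start: "segment_path C x S y \<Longrightarrow> x \<in> verts (double C)"
  by (cases "(C, x, S, y)" rule: segment_path.cases) (auto dest: is_path_start dsv_in_verts_double)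

lemma segment_path_append:
  "segment_path C x (S @ T) y \<longleftrightarrow> (\<exists>z. segment_path C x S z \<and> segment_path C z T y)"
proof (induction S arbitrary: x)
  case (Cons seg S)
  then show ?case by (cases seg) auto
qed (auto dest: segment_path_start)

lemma is_path_segment_word:
  "segment_path C x S y \<Longrightarrow> is_path (double C) x (segment_word (dse C) S) y"
proof (induction S arbitrary: x)
  case (Cons seg S)
  obtain c p where seg: "seg = (c, p)" by fastforce
  with Cons.prems obtain u v where x: "x = dsv C c u" and p: "is_path C u p v"
    and S: "segment_path C (dsv C c v) S y" by auto
  have "is_path (double C) x (word (dse C c) p @ segment_word (dse C) S) y"
    unfolding x double.is_path_append using is_path_word_dse[OF p] Cons.IH[OF S] by blast
  then show ?case by (simp add: seg)
qed simp

lemma is_path_segmented: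
  "is_path (double C) x p y \<Longrightarrow> \<exists>S. segment_path C x S y \<and> p = segment_word (dse C) S"
proof (induction p arbitrary: x)
  case Nil
  then show ?case by (intro exI[of _ "[]"]) auto
next
  case (Cons d p)
  then obtain c e where d: "fst d = dse C c e" "e \<in> edges C" by (auto simp: double_def)
  interpret cellular_map C "double C" "dsv C c" "dse C c" "\<lambda>f. (f, c)"
    by (rule cellular_map_double)
  have ends: "x = dsv C c (dstart C (e, snd d))" "dend (double C) d = dsv C c (dend C (e, snd d))"
    using Cons.prems d by (auto simp: dstart_def dend_def src_image tgt_image)
  have "is_path (double C) (dend (double C) d) p y" using Cons.prems by simp
  from Cons.IH[OF this] obtain S
    where S: "segment_path C (dend (double C) d) S y" "p = segment_word (dse C) S" by blast
  have "is_path C (dstart C (e, snd d)) [(e, snd d)] (dend C (e, snd d))"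
    using d(2) by (simp add: dend_def src_in_verts tgt_in_verts)
  then have "segment_path C x ((c, [(e, snd d)]) # S) y" using S(1) ends by auto
  moreover have "d # p = segment_word (dse C) ((c, [(e, snd d)]) # S)"
    using S(2) d(1) by (simp add: prod_eq_iff)
  ultimately show ?case by blast
qed

definition contractible :: "(bool \<times> ('e \<times> bool) list) list \<Rightarrow> bool" where
  "contractible S \<longleftrightarrow>
     (\<forall>x. segment_path C x S x \<longrightarrow> homotopic (double C) x (segment_word (dse C) S) [] x)"

lemma contractibleI:
  "(\<And>x. segment_path C x S x \<Longrightarrow> homotopic (double C) x (segment_word (dse C) S) [] x) \<Longrightarrow> contractible S"
  by (simp add: contractible_def)

lemma contractibleD:
  "contractible S \<Longrightarrow> segment_path C x S x \<Longrightarrow> homotopic (double C) x (segment_word (dse C) S) [] x"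
  by (simp only: contractible_def)

lemma contractible_Nil: "contractible []"
  by (rule contractibleI) (simp add: homotopic_refl)

lemma contractible_merge:
  assumes "contractible (A @ (c, p @ q) # B)"
  shows "contractible (A @ (c, p) # (c, q) # B)"
proof (rule contractibleI)
  fix x assume "segment_path C x (A @ (c, p) # (c, q) # B) x"
  then have "segment_path C x (A @ (c, p @ q) # B) x"
    by (fastforce simp: segment_path_append is_path_append dsv_eq_iff)
  from contractibleD[OF assms this]
  show "homotopic (double C) x (segment_word (dse C) (A @ (c, p) # (c, q) # B)) [] x" by simp
qed

lemma contractible_rotate:
  assumes "contractible (rotate k S)"
  shows "contractible S"
proof (rule contractibleI)
  fix x assume loop: "segment_path C x S x"
  obtain A B where S: "S = A @ B" and rotate: "rotate k S = B @ A"
    by (metis append_take_drop_id rotate_drop_take)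
  from loop obtain y where A: "segment_path C x A y" and B: "segment_path C y B x"
    by (auto simp: S segment_path_append)
  then have "segment_path C y (rotate k S) y" unfolding rotate segment_path_append by blast
  from contractibleD[OF assms this]
  have "homotopic (double C) y (segment_word (dse C) B @ segment_word (dse C) A) [] y"
    by (simp add: rotate)
  from double.homotopic_Nil_append_commute[OF is_path_segment_word[OF A] is_path_segment_word[OF B] this]
  show "homotopic (double C) x (segment_word (dse C) S) [] x" by (simp add: S)
qed

end

section \<open>Essential diagrams\<close>

locale essential_diagram =
  fixes K0 :: "'k set" and EK :: "'k \<Rightarrow> 'k \<Rightarrow> bool" and L0 :: "'k set"
    and C :: "('v, 'e, 'f) cplx" and lab :: "'e \<Rightarrow> 'k"
  assumes L0_subset: "L0 \<subseteq> K0"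
    and diagram: "vk_diagram K0 EK C lab"
    and essential: "essential K0 EK L0 C lab"
    and boundary_labels: "e \<in> bd_edges C \<Longrightarrow> lab e \<in> L0"
begin

sublocale doubled_complex C
  using diagram by unfold_locales (auto simp: vk_diagram_def surface_def cplx_wf_def)

lemma face_word_trivial:
  assumes "f \<in> faces C"
  shows "raag_eq EK (word lab (bnd C f)) []"
proof -
  obtain k a b where "EK a b"
    and "word lab (bnd C f) = rotate k [(a, True), (b, True), (a, False), (b, False)]"
    using diagram assms unfolding vk_diagram_def by blast
  then show ?thesis using raag_eq_commutator[of EK a b True True] by (simp add: raag_eq_Nil_rotate)
qed

lemma word_dlab_word_dse: "word (dlab L0 lab) (word (dse C c) p) = word (dblv L0 c) (word lab p)"
  by (simp add: word_word) (rule word_cong, auto simp: dlab_def dse_def dblv_def boundary_labels)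

lemma word_dlab_segment_word:
  "word (dlab L0 lab) (segment_word (dse C) S) = segment_word (dblv L0) (map (apsnd (word lab)) S)"
  by (induction S) (auto simp: word_dlab_word_dse)

lemma double_face_word_trivial:
  assumes "f \<in> faces (double C)"
  shows "raag_eq (dblE EK L0) (word (dlab L0 lab) (bnd (double C) f)) []"
proof -
  obtain g c where f: "f = (g, c)" "g \<in> faces C" using assms by (auto simp: double_def)
  have "bnd (double C) f = word (dse C c) (bnd C g)"
    using cellular_map.bnd_image[OF cellular_map_double] f by metis
  then show ?thesis
    using raag_eq_word_dblv[OF face_word_trivial[OF f(2)]] by (simp add: word_dlab_word_dse)
qed

lemma parabolic_path_into_boundary:
  assumes "is_path C u p w" "u \<in> bd_verts C" "w \<in> bd_verts C" "in_parabolic EK L0 (word lab p)"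
  obtains q where "fst ` set q \<subseteq> bd_edges C" "homotopic C u p q w"
proof -
  have "rcont K0 EK (word lab p) \<subseteq> L0"
    using assms(4) L0_subset unfolding rcont_def by blast
  then have "\<not> essential_arc C p" using essential unfolding essential_def by blast
  then show ?thesis using assms(1-3) that unfolding essential_arc_def by blast
qed

lemma parabolic_path_switch:
  assumes p: "is_path C u p w" "u \<in> bd_verts C" "w \<in> bd_verts C" "in_parabolic EK L0 (word lab p)"
  obtains q where "is_path C u q w"
    and "homotopic (double C) (dsv C c u) (word (dse C c) p) (word (dse C c') q) (dsv C c w)"
proof -
  from parabolic_path_into_boundary[OF p] obtain q
    where q: "fst ` set q \<subseteq> bd_edges C" and homotopy: "homotopic C u p q w" .
  have "homotopic (double C) (dsv C c u) (word (dse C c) p) (word (dse C c') q) (dsv C c w)"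
    using cellular_map.homotopic_word[OF cellular_map_double homotopy, of c]
    by (simp add: word_dse_boundary[OF q, of c' c])
  with homotopic_is_path(2)[OF homotopy] show ?thesis by (rule that)
qed

abbreviation trivial_word :: "(bool \<times> ('e \<times> bool) list) list \<Rightarrow> bool" where
  "trivial_word S \<equiv> raag_eq (dblE EK L0) (word (dlab L0 lab) (segment_word (dse C) S)) []"

lemma trivial_word_rotate:
  assumes "trivial_word S"
  shows "trivial_word (rotate k S)"
proof -
  obtain A B where "S = A @ B" "rotate k S = B @ A"
    by (metis append_take_drop_id rotate_drop_take)
  with assms show ?thesis by (simp add: raag_eq_Nil_append_commute)
qed

lemma contractible_singleton:
  assumes "trivial_word [(c, p)]"
  shows "contractible [(c, p)]"
proof (rule contractibleI)
  fix x assume "segment_path C x [(c, p)] x"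
  then obtain u where x: "x = dsv C c u" and p: "is_path C u p u" by (auto simp: dsv_eq_iff)
  have "raag_eq (dblE EK L0) (word (dblv L0 c) (word lab p)) []"
    using assms by (simp add: word_dlab_word_dse)
  from raag_eq_word_fst[OF this] have "raag_eq EK (word lab p) (word lab [])" by simp
  then have "homotopic C u p [] u"
    using essential p is_path_start[OF p] unfolding essential_def faithful_def by fastforce
  from cellular_map.homotopic_word[OF cellular_map_double this]
  show "homotopic (double C) x (segment_word (dse C) [(c, p)]) [] x" by (simp add: x)
qed

text \<open>The neighbours of a segment in the other copy force its end points onto the boundary.\<close>

lemma contractible_switch:
  assumes trivial: "trivial_word ((c, p) # (d, r) # T)"
    and alternating: "cyclically_alternating ((c, p) # (d, r) # T)"
    and parabolic: "in_parabolic EK L0 (word lab p)"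
    and merged: "\<And>q. trivial_word ((d, q @ r) # T) \<Longrightarrow> contractible ((d, q @ r) # T)"
  shows "contractible ((c, p) # (d, r) # T)"
proof (rule contractibleI)
  let ?T = "(d, r) # T"
  fix x assume "segment_path C x ((c, p) # ?T) x"
  then obtain u v where x: "x = dsv C c u" and p: "is_path C u p v"
    and T: "segment_path C (dsv C c v) ?T x" by auto
  have colours: "d \<noteq> c" "fst (last ?T) \<noteq> c"
    using cyclically_alternating_ConsD[OF alternating] by simp_all
  have v: "v \<in> bd_verts C" using T colours(1) by (auto simp: dsv_eq_iff)
  obtain U d' s where last: "?T = U @ [(d', s)]" by (metis rev_exhaust surj_pair list.distinct(1))
  have u: "u \<in> bd_verts C"
    using T colours(2) unfolding last x by (auto simp: segment_path_append dsv_eq_iff)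
  from parabolic_path_switch[OF p u v parabolic] obtain q where q: "is_path C u q v"
    and switch: "homotopic (double C) (dsv C c u) (word (dse C c) p) (word (dse C d) q) (dsv C c v)" .
  have "is_path (double C) x [] (dsv C c u)"
    using is_path_end[OF is_path_segment_word[OF T]] x by simp
  from double.homotopic_context[OF switch this is_path_segment_word[OF T]]
  have switched: "homotopic (double C) x (segment_word (dse C) ((c, p) # ?T))
      (segment_word (dse C) ((d, q) # ?T)) x" by simp
  have "trivial_word ((d, q) # ?T)"
    using homotopic_raag_eq[OF switched double_face_word_trivial] trivial raag_eq_trans raag_eq_sym
    by blast
  then have "contractible ((d, q @ r) # T)" by (intro merged) simp
  then have "contractible ((d, q) # ?T)" using contractible_merge[of "[]"] by simp
  moreover have "segment_path C x ((d, q) # ?T) x"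
    using q T u v x by (auto simp: dsv_eq_iff)
  ultimately have "homotopic (double C) x (segment_word (dse C) ((d, q) # ?T)) [] x"
    by (rule contractibleD)
  with switched show "homotopic (double C) x (segment_word (dse C) ((c, p) # ?T)) [] x"
    by (rule homotopic_trans)
qed

lemma parabolic_segment:
  assumes "trivial_word S" "distinct_adj (map fst S)" "S \<noteq> []"
  obtains A c p B where "S = A @ (c, p) # B" "in_parabolic EK L0 (word lab p)"
proof -
  have "\<exists>(c, p) \<in> set S. in_parabolic EK L0 (word lab p)"
    using alternating_product_nontrivial[of "map (apsnd (word lab)) S" EK L0] assms
    by (fastforce simp: word_dlab_segment_word comp_def)
  then show ?thesis using that by (auto dest!: split_list)
qed

lemma contractible_if_trivial_word: "trivial_word S \<Longrightarrow> contractible S"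
proof (induction "length S" arbitrary: S rule: less_induct)
  case less
  consider (short) "length S \<le> 1"
    | (repeated) "\<not> cyclically_alternating S"
    | (alternating) "length S > 1" "cyclically_alternating S"
    by fastforce
  then show ?case
  proof cases
    case short
    then show ?thesis
      using less.prems contractible_Nil contractible_singleton by (cases S) auto
  next
    case repeated
    then obtain k A c p q B where rotated: "rotate k S = A @ (c, p) # (c, q) # B"
      by (rule not_cyclically_alternatingE)
    have "trivial_word (A @ (c, p @ q) # B)"
      using trivial_word_rotate[OF less.prems, of k] by (simp add: rotated)
    moreover have "length (A @ (c, p @ q) # B) < length S"
      using arg_cong[OF rotated, of length] by simp
    ultimately have "contractible (rotate k S)"
      unfolding rotated by (intro contractible_merge less.hyps)
    then show ?thesis by (rule contractible_rotate)
  next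
    case alternating
    then have "distinct_adj (map fst S)" "S \<noteq> []"
      using cyclically_alternating_imp_distinct_adj by auto
    from parabolic_segment[OF less.prems this] obtain A c p B
      where S: "S = A @ (c, p) # B" and parabolic: "in_parabolic EK L0 (word lab p)" .
    then obtain d r T where T: "B @ A = (d, r) # T" using alternating(1) by (cases "B @ A") auto
    have rotated: "rotate (length A) S = (c, p) # (d, r) # T" by (simp add: S rotate_append T)
    have "contractible ((d, q @ r) # T)" if "trivial_word ((d, q @ r) # T)" for q
      using that arg_cong[OF T, of length] by (intro less.hyps) (simp_all add: S)
    then have "contractible (rotate (length A) S)"
      using trivial_word_rotate[OF less.prems, of "length A"] parabolic
        cyclically_alternating_rotate[OF alternating(2), of "length A"]
      unfolding rotated by (intro contractible_switch)
    then show ?thesis by (rule contractible_rotate)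
  qed
qed

end

theorem theorem4p2:
  fixes K0 :: "'k set" and EK :: "'k \<Rightarrow> 'k \<Rightarrow> bool" and L0 :: "'k set"
    and C :: "('v, 'e, 'f) cplx" and lab :: "'e \<Rightarrow> 'k"
  assumes "finite_graph K0 EK"
    and "L0 \<subseteq> K0"
    and "vk_diagram K0 EK C lab"
    and "essential K0 EK L0 C lab"
    and "\<forall>e\<in>bd_edges C. lab e \<in> L0"
  shows "faithful (dblE EK L0) (double C) (dlab L0 lab)"
proof -
  interpret essential_diagram K0 EK L0 C lab
    using assms(2-) by unfold_locales auto
  show ?thesis
  proof (rule double.faithfulI)
    fix x p
    assume "is_path (double C) x p x" and trivial: "raag_eq (dblE EK L0) (word (dlab L0 lab) p) []"
    then obtain S where S: "segment_path C x S x" "p = segment_word (dse C) S"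
      using is_path_segmented by blast
    then have "contractible S" using trivial by (simp add: contractible_if_trivial_word)
    then show "homotopic (double C) x p [] x" unfolding S(2) using S(1) by (rule contractibleD)
  qed
qed

end
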